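(* For every $n\ge 1$, the triples of statistics $(\mathrm{aix},\mathrm{des},\mathrm{aid})$ and $(\mathrm{pix},\mathrm{lec},\mathrm{inv})$ are equidistributed on $\mathfrak{S}_n$: for all $a,b,c\in\mathbb{N}=\{0,1,2,\dots\}$, $$|\{\pi\in\mathfrak{S}_n:(\mathrm{aix},\mathrm{des},\mathrm{aid})\,\pi=(a,b,c)\}|=|\{\pi\in\mathfrak{S}_n:(\mathrm{pix},\mathrm{lec},\mathrm{inv})\,\pi=(a,b,c)\}|.$$
   Context: $\mathfrak{S}_n$ is the set of permutations of $[n]=\{1,\dots,n\}$, written as words $\pi(1)\pi(2)\cdots\pi(n)$. The statistics below are also used for words $\pi=\pi(1)\cdots\pi(r)$ of distinct letters from a totally ordered set. $\mathrm{des}\,\pi=|\{i:\pi(i)>\pi(i+1)\}|$; $\mathrm{Inv}\,\pi=\{(i,j): i<j,\ \pi(i)>\pi(j)\}$ and $\mathrm{inv}\,\pi=|\mathrm{Inv}\,\pi|$. Statistic aid: an inversion $(i,j)\in\mathrm{Inv}\,\pi$ is admissible if either $\pi(j)<\pi(j+1)$ (this alternative requires that position $j+1$ exists) or $\pi(j)>\pi(k)$ for some $k$ with $i<k<j$. Let $\mathrm{ai}\,\pi$ be the number of admissible inversions of $\pi$, and $\mathrm{aid}\,\pi=\mathrm{ai}\,\pi+\mathrm{des}\,\pi$. Statistics lec and pix: a word $w=w_1w_2\cdots w_r$ with $r\ge 2$ is a hook if $w_1>w_2\le w_3\le\dots\le w_r$. Every word $\pi$ factors uniquely as a concatenation $\pi=\pi_0\pi_1\cdots\pi_k$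 ($k\ge 0$) with $\pi_0$ a (possibly empty) nondecreasing word and each $\pi_i$, $1\le i\le k$, a hook. Then $\mathrm{lec}\,\pi=\sum_{i=1}^k\mathrm{inv}\,\pi_i$ and $\mathrm{pix}\,\pi=|\pi_0|$, the length of $\pi_0$. Statistic aix: defined recursively by $\mathrm{aix}\,\emptyset=0$ and, for $\pi\ne\emptyset$ with smallest letter $m$, writing $\pi=\alpha m\beta$ where $\alpha$ does not contain $m$: $\mathrm{aix}\,\pi=1+\mathrm{aix}\,\beta$ if $\alpha=\emptyset$; $\mathrm{aix}\,\pi=0$ if $\alpha\neq\emptyset$ and $\beta=\emptyset$; $\mathrm{aix}\,\pi=\mathrm{aix}\,\alpha$ if $\alpha\ne\emptyset$ and $\beta\ne\emptyset$. *)

theory Defs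
  imports Main "HOL-Combinatorics.Multiset_Permutations"
begin

text \<open>
  Words are lists. Positions are counted from 0, so position \<open>i\<close> of a word here is position
  \<open>i + 1\<close> in the usual one-based notation. The permutations of \<open>{1, \<dots>, n}\<close>, as words, are the
  elements of \<open>permutations_of_set {1..n}\<close>.
\<close>

definition des :: "'a::linorder list \<Rightarrow> nat" where
  "des w = card {i. Suc i < length w \<and> w ! i > w ! Suc i}"

definition inversion_set :: "'a::linorder list \<Rightarrow> (nat \<times> nat) set" where
  "inversion_set w = {(i, j). i < j \<and> j < length w \<and> w ! i > w ! j}"

definition inv_stat :: "'a::linorder list \<Rightarrow> nat" where
  "inv_stat w = card (inversion_set w)"

definition admissible :: "'a::linorder list \<Rightarrow> nat \<times> nat \<Rightarrow> bool" where
  "admissible w = (\<lambda>(i, j).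
     (Suc j < length w \<and> w ! j < w ! Suc j) \<or> (\<exists>k. i < k \<and> k < j \<and> w ! j > w ! k))"

definition ai :: "'a::linorder list \<Rightarrow> nat" where
  "ai w = card {p \<in> inversion_set w. admissible w p}"

definition aid :: "'a::linorder list \<Rightarrow> nat" where
  "aid w = ai w + des w"

definition hook :: "'a::linorder list \<Rightarrow> bool" where
  "hook w \<longleftrightarrow> 2 \<le> length w \<and> w ! 0 > w ! 1 \<and> sorted (tl w)"

definition is_hook_factorization :: "'a::linorder list \<Rightarrow> 'a list \<times> 'a list list \<Rightarrow> bool" where
  "is_hook_factorization w = (\<lambda>(w0, hs).
     w = w0 @ concat hs \<and> sorted w0 \<and> (\<forall>h \<in> set hs. hook h))"

lemma hook_Cons_iff: "hook (x # t) \<longleftrightarrow> t \<noteq> [] \<and> hd t < x \<and> sorted t"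
  by (cases t) (auto simp: hook_def)

lemma is_hook_factorization_Cons_iff:
  "is_hook_factorization (x # w) (w0, hs) \<longleftrightarrow>
     (\<exists>t. w0 = x # t \<and> (t = [] \<or> x \<le> hd t) \<and> is_hook_factorization w (t, hs)) \<or>
     (\<exists>t hs'. w0 = [] \<and> hs = (x # t) # hs' \<and> t \<noteq> [] \<and> hd t < x \<and>
        is_hook_factorization w (t, hs'))"
proof (cases w0)
  case Nil
  show ?thesis
  proof (cases hs)
    case (Cons h hs')
    have "\<not> hook []"
      by (simp add: hook_def)
    then show ?thesis
      using Nil Cons by (cases h) (auto simp: is_hook_factorization_def hook_Cons_iff)
  qed (use Nil in \<open>auto simp: is_hook_factorization_def\<close>)
next
  case (Cons y t)
  then show ?thesis
    by (cases t) (auto simp: is_hook_factorization_def)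
qed

lemma hook_factorization_ex1: "\<exists>!p. is_hook_factorization w p"
proof (induction w)
  case Nil
  have "hs = []" if "concat hs = []" "\<forall>h \<in> set hs. hook h" for hs :: "'a list list"
    using that by (cases hs) (auto simp: hook_def)
  then show ?case
    by (intro ex1I[of _ "([], [])"]) (auto simp: is_hook_factorization_def)
next
  case (Cons x w)
  then obtain t hs where p: "is_hook_factorization w (t, hs)"
    and u: "\<And>t' hs'. is_hook_factorization w (t', hs') \<Longrightarrow> t' = t \<and> hs' = hs"
    by (metis prod.exhaust prod.inject)
  show ?case
  proof (cases "t = [] \<or> x \<le> hd t")
    case True
    show ?thesis
    proof (rule ex1I[of _ "(x # t, hs)"])
      show "is_hook_factorization (x # w) (x # t, hs)"
        using p True by (simp add: is_hook_factorization_Cons_iff)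
    next
      fix q assume "is_hook_factorization (x # w) q"
      then show "q = (x # t, hs)"
        using u True by (cases q) (force simp: is_hook_factorization_Cons_iff)
    qed
  next
    case False
    show ?thesis
    proof (rule ex1I[of _ "([], (x # t) # hs)"])
      show "is_hook_factorization (x # w) ([], (x # t) # hs)"
        using p False by (auto simp: is_hook_factorization_Cons_iff not_le)
    next
      fix q assume "is_hook_factorization (x # w) q"
      then show "q = ([], (x # t) # hs)"
        using u False by (cases q) (force simp: is_hook_factorization_Cons_iff)
    qed
  qed
qed

definition hook_factorization :: "'a::linorder list \<Rightarrow> 'a list \<times> 'a list list" where
  "hook_factorization w = (THE p. is_hook_factorization w p)"

definition lec :: "'a::linorder list \<Rightarrow> nat" where
  "lec w = (\<Sum>h\<leftarrow>snd (hook_factorization w). inv_stat h)"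

definition pix :: "'a::linorder list \<Rightarrow> nat" where
  "pix w = length (fst (hook_factorization w))"

function aix :: "'a::linorder list \<Rightarrow> nat" where
  "aix w =
     (if w = [] then 0
      else let m = Min (set w);
               \<alpha> = takeWhile (\<lambda>x. x \<noteq> m) w;
               \<beta> = tl (dropWhile (\<lambda>x. x \<noteq> m) w)
           in if \<alpha> = [] then 1 + aix \<beta>
              else if \<beta> = [] then 0
              else aix \<alpha>)"
  by auto
termination
proof (relation "measure length", goal_cases)
  case 1
  show ?case by simp
next
  case (2 w m \<alpha> \<beta>)
  have "length (dropWhile (\<lambda>x. x \<noteq> m) w) \<le> length w"
    by (rule length_dropWhile_le)
  moreover have "length w > 0"
    using 2 by simp
  ultimately have "length (tl (dropWhile (\<lambda>x. x \<noteq> m) w)) < length w"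
    unfolding length_tl by linarith
  then show ?case
    using 2 by simp
next
  case (3 w m \<alpha> \<beta>)
  have "dropWhile (\<lambda>x. x \<noteq> m) w \<noteq> []"
    using 3(4,6) by (metis list.sel(2))
  moreover have "length \<alpha> + length (dropWhile (\<lambda>x. x \<noteq> m) w) = length w"
    using 3(3) by (metis length_append takeWhile_dropWhile_id)
  ultimately show ?case
    by (cases "dropWhile (\<lambda>x. x \<noteq> m) w") auto
qed

declare aix.simps [simp del]

end

(*
  Fix a real q > 0 and encode f as the q-exponential series F(u) = sum of f(n) u^n / [n]_q!.
  Products of such series describe splittings of a letter set into two blocks, weighted by
  q to the number of inversions between the blocks, and the q-derivative D satisfies the
  q-Leibniz rule D(FG) = DF G + F(qu) DG.

  Put s = tq, E_x = e_q(xu) and H = sum over n of (s + ... + s^(n-1)) u^n / [n]_q!, the series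
  of hooks. Removing the last hook of a word gives W_x = E_x + W_x H for the series of
  (pix, lec, inv). Cutting a word at its smallest letter gives
  D A_x = x A_x + s A_x(qu) (A_1 - 1) for the series of (aix, des, aid). By the q-Leibniz rule,
  W_x = E_x / (1 - H) solves the latter equation too, and the two series coincide.
  Putting q = z, t = z^M, x = z^(M^2) with M large turns the equality of the series into one of
  polynomials in z whose exponents determine the three statistics.
*)

theory Submission
  imports Defs "HOL-Computational_Algebra.Formal_Power_Series"
    "HOL-Computational_Algebra.Polynomial"
begin

section \<open>q-exponential series\<close>

text \<open>A sum instead of the quotient (q^n - 1) / (q - 1), so that q = 1 is covered as
  well.\<close>

definition qint :: "real \<Rightarrow> nat \<Rightarrow> real" where
  "qint q n = (\<Sum>i<n. q ^ i)"

primrec qfact :: "real \<Rightarrow> nat \<Rightarrow> real" where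
  "qfact q 0 = 1"
| "qfact q (Suc n) = qint q (Suc n) * qfact q n"

text \<open>Undoes the normalisation of \<open>qgf\<close> for \<open>q > 0\<close>, where no
  q-factorial vanishes. In these coordinates \<open>qderiv\<close> is the shift.\<close>

definition qcoeff :: "real \<Rightarrow> real fps \<Rightarrow> nat \<Rightarrow> real" where
  "qcoeff q F n = qfact q n * fps_nth F n"

definition qgf :: "real \<Rightarrow> (nat \<Rightarrow> real) \<Rightarrow> real fps" where
  "qgf q f = Abs_fps (\<lambda>n. f n / qfact q n)"

text \<open>The q-derivative (F(qu) - F(u)) / ((q - 1) u), given by coefficients so that it makes
  sense at q = 1; \<open>qscale\<close> is the substitution F(qu).\<close>

definition qderiv :: "real \<Rightarrow> real fps \<Rightarrow> real fps" where
  "qderiv q F = Abs_fps (\<lambda>n. qint q (Suc n) * fps_nth F (Suc n))"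

definition qscale :: "real \<Rightarrow> real fps \<Rightarrow> real fps" where
  "qscale q F = Abs_fps (\<lambda>n. q ^ n * fps_nth F n)"

section \<open>Coefficient rules and the q-Leibniz rule\<close>

lemma qint_0 [simp]: "qint q 0 = 0"
  by (simp add: qint_def)

lemma qint_pos: "q > 0 \<Longrightarrow> n > 0 \<Longrightarrow> qint q n > 0"
  unfolding qint_def by (intro sum_pos) auto

lemma qfact_pos: "q > 0 \<Longrightarrow> qfact q n > 0"
  by (induction n) (auto simp: qint_pos simp del: One_nat_def)

lemma qint_add: "qint q (m + n) = qint q m + q ^ m * qint q n"
  by (induction n) (auto simp: qint_def algebra_simps power_add)

lemma qcoeff_0 [simp]: "qcoeff q F 0 = fps_nth F 0"
  by (simp add: qcoeff_def)

lemma qcoeff_add: "qcoeff q (F + G) n = qcoeff q F n + qcoeff q G n"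
  by (simp add: qcoeff_def algebra_simps)

lemma qcoeff_diff: "qcoeff q (F - G) n = qcoeff q F n - qcoeff q G n"
  by (simp add: qcoeff_def algebra_simps)

lemma qcoeff_const_mult: "qcoeff q (fps_const c * F) n = c * qcoeff q F n"
  by (simp add: qcoeff_def)

lemma qcoeff_one: "qcoeff q 1 n = (if n = 0 then 1 else 0)"
  by (simp add: qcoeff_def)

lemma qcoeff_qgf: "q > 0 \<Longrightarrow> qcoeff q (qgf q f) n = f n"
  using qfact_pos[of q n] by (simp add: qcoeff_def qgf_def)

lemma qcoeff_qderiv: "qcoeff q (qderiv q F) n = qcoeff q F (Suc n)"
  by (simp add: qcoeff_def qderiv_def)

lemma qcoeff_qscale: "qcoeff q (qscale q F) n = q ^ n * qcoeff q F n"
  by (simp add: qcoeff_def qscale_def)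

lemma qcoeff_eqI:
  assumes "q > 0" "\<And>n. qcoeff q F n = qcoeff q G n"
  shows "F = G"
proof (rule fps_ext)
  fix n
  show "fps_nth F n = fps_nth G n"
    using assms(2)[of n] qfact_pos[OF assms(1), of n] by (simp add: qcoeff_def)
qed

lemma qderiv_diff: "qderiv q (F - G) = qderiv q F - qderiv q G"
  by (rule fps_ext) (simp add: qderiv_def algebra_simps)

lemma qderiv_one [simp]: "qderiv q 1 = 0"
  by (rule fps_ext) (simp add: qderiv_def)

text \<open>At each k the factor [n+1] splits as [k] + q^k [n+1-k]. The first summand differentiates
  F, the second scales F and differentiates G.\<close>

lemma qderiv_mult: "qderiv q (F * G) = qderiv q F * G + qscale q F * qderiv q G"
proof (rule fps_ext)
  fix n
  let ?f = "fps_nth F" and ?g = "fps_nth G"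
  have "fps_nth (qderiv q (F * G)) n = (\<Sum>k=0..Suc n. qint q (Suc n) * (?f k * ?g (Suc n - k)))"
    by (simp only: qderiv_def fps_mult_nth fps_nth_Abs_fps sum_distrib_left)
  also have "\<dots> = (\<Sum>k=0..Suc n. qint q k * ?f k * ?g (Suc n - k)
      + q ^ k * ?f k * (qint q (Suc n - k) * ?g (Suc n - k)))"
  proof (intro sum.cong refl)
    fix k assume "k \<in> {0..Suc n}"
    then have "qint q (Suc n) = qint q k + q ^ k * qint q (Suc n - k)"
      using qint_add[of q k "Suc n - k"] by simp
    then show "qint q (Suc n) * (?f k * ?g (Suc n - k)) = qint q k * ?f k * ?g (Suc n - k)
      + q ^ k * ?f k * (qint q (Suc n - k) * ?g (Suc n - k))"
      by (simp add: algebra_simps)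
  qed
  also have "\<dots> = (\<Sum>k=0..Suc n. qint q k * ?f k * ?g (Suc n - k))
      + (\<Sum>k=0..Suc n. q ^ k * ?f k * (qint q (Suc n - k) * ?g (Suc n - k)))"
    by (rule sum.distrib)
  \<comment> \<open>The term k = 0 vanishes because \<open>qint q 0 = 0\<close>, so the index can be
    shifted; in the other sum the last term vanishes for the same reason.\<close>
  also have "(\<Sum>k=0..Suc n. qint q k * ?f k * ?g (Suc n - k)) = fps_nth (qderiv q F * G) n"
    by (subst sum.atLeast0_atMost_Suc_shift) (simp add: fps_mult_nth qderiv_def)
  also have "(\<Sum>k=0..Suc n. q ^ k * ?f k * (qint q (Suc n - k) * ?g (Suc n - k)))
      = fps_nth (qscale q F * qderiv q G) n"
    by (auto simp: fps_mult_nth qderiv_def qscale_def Suc_diff_le intro!: sum.cong)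
  finally show "fps_nth (qderiv q (F * G)) n = fps_nth (qderiv q F * G + qscale q F * qderiv q G) n"
    by simp
qed

section \<open>Splitting letter sets into blocks\<close>

text \<open>The inversions between two blocks when the letters of U stand before those of V,
  whatever the order inside the blocks.\<close>

definition cross_inv :: "'a::linorder set \<Rightarrow> 'a set \<Rightarrow> nat" where
  "cross_inv U V = card {(u, v). u \<in> U \<and> v \<in> V \<and> v < u}"

lemma cross_inv_insert_left_min:
  assumes "\<forall>v\<in>V. b < v"
  shows "cross_inv (insert b U) V = cross_inv U V"
  unfolding cross_inv_def using assms by (intro arg_cong[where f = card]) force

lemma cross_inv_insert_right_min:
  assumes "finite U" "finite V" "\<forall>u\<in>U. b < u" "b \<notin> V"
  shows "cross_inv U (insert b V) = card U + cross_inv U V"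
proof -
  have "{(u, v). u \<in> U \<and> v \<in> insert b V \<and> v < u}
      = (\<lambda>u. (u, b)) ` U \<union> {(u, v). u \<in> U \<and> v \<in> V \<and> v < u}"
    using assms by auto
  moreover have "finite {(u, v). u \<in> U \<and> v \<in> V \<and> v < u}"
    by (rule finite_subset[of _ "U \<times> V"]) (use assms in auto)
  moreover have "card ((\<lambda>u. (u, b)) ` U) = card U"
    by (intro card_image inj_onI) auto
  moreover have "(\<lambda>u. (u, b)) ` U \<inter> {(u, v). u \<in> U \<and> v \<in> V \<and> v < u} = {}"
    using assms by auto
  ultimately show ?thesis
    unfolding cross_inv_def using assms(1) by (simp add: card_Un_disjoint)
qed

text \<open>A q-binomial convolution, summed over subsets instead of sizes. Removing the smallest
  letter turns it into the q-Leibniz rule; F and G vary in the induction because they are replaced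
  by q-derivatives and scalings.\<close>

lemma qcoeff_mult_Pow:
  fixes S :: "'a::linorder set"
  assumes "finite S"
  shows "qcoeff q (F * G) (card S) =
    (\<Sum>U\<in>Pow S. q ^ cross_inv U (S - U) * qcoeff q F (card U) * qcoeff q G (card (S - U)))"
  using assms
proof (induction S arbitrary: F G rule: finite_linorder_min_induct)
  case empty
  then show ?case
    by (simp add: cross_inv_def)
next
  case (insert b A)
  let ?t = "\<lambda>F G S U. q ^ cross_inv U (S - U) * qcoeff q F (card U) * qcoeff q G (card (S - U))"
  have b: "b \<notin> A"
    using insert by auto
  have "(\<Sum>U\<in>Pow (insert b A). ?t F G (insert b A) U)
      = (\<Sum>U\<in>Pow A. ?t F G (insert b A) U) + (\<Sum>U\<in>insert b ` Pow A. ?t F G (insert b A) U)"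
    unfolding Pow_insert using insert b by (intro sum.union_disjoint) auto
  \<comment> \<open>With \<open>b\<close> in the right block, its inversions contribute
    \<open>q ^ card U\<close>, absorbed by \<open>qscale\<close>, and the larger right block turns G
    into \<open>qderiv q G\<close>.\<close>
  also have "(\<Sum>U\<in>Pow A. ?t F G (insert b A) U)
      = (\<Sum>U\<in>Pow A. ?t (qscale q F) (qderiv q G) A U)"
  proof (intro sum.cong refl)
    fix U assume U: "U \<in> Pow A"
    then have fin: "finite U" "finite (A - U)"
      using insert finite_subset by auto
    have "insert b A - U = insert b (A - U)"
      using U b by auto
    moreover have "cross_inv U (insert b (A - U)) = card U + cross_inv U (A - U)"
      using U b fin insert by (intro cross_inv_insert_right_min) auto
    ultimately show "?t F G (insert b A) U = ?t (qscale q F) (qderiv q G) A U"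
      using b fin by (simp add: qcoeff_qscale qcoeff_qderiv power_add)
  qed
  \<comment> \<open>With \<open>b\<close> in the left block there is no new inversion across, and F
    becomes \<open>qderiv q F\<close>.\<close>
  also have "(\<Sum>U\<in>insert b ` Pow A. ?t F G (insert b A) U)
      = (\<Sum>U\<in>Pow A. ?t F G (insert b A) (insert b U))"
    using b by (subst sum.reindex) (auto simp: inj_on_def)
  also have "\<dots> = (\<Sum>U\<in>Pow A. ?t (qderiv q F) G A U)"
  proof (intro sum.cong refl)
    fix U assume U: "U \<in> Pow A"
    then have fin: "finite U" and "b \<notin> U"
      using insert finite_subset b by auto
    moreover have "insert b A - insert b U = A - U"
      using U b by auto
    moreover have "cross_inv (insert b U) (A - U) = cross_inv U (A - U)"
      using insert by (intro cross_inv_insert_left_min) auto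
    ultimately show "?t F G (insert b A) (insert b U) = ?t (qderiv q F) G A U"
      by (simp add: qcoeff_qderiv)
  qed
  finally show ?case
    using b insert.hyps insert.IH
    by (simp add: qcoeff_qderiv[symmetric] qderiv_mult qcoeff_add)
qed

section \<open>The generating series of words by hooks\<close>

text \<open>
  The sum of \<open>s\<close> to the number of inversions over the hooks on \<open>n\<close> letters: for each \<open>0 < j < n\<close>
  exactly one hook has \<open>j\<close> inversions.
\<close>
definition hook_count :: "real \<Rightarrow> nat \<Rightarrow> real" where
  "hook_count s n = (if n = 0 then 0 else (\<Sum>j<n. s ^ j) - 1)"

definition hook_gf :: "real \<Rightarrow> real \<Rightarrow> real fps" where
  "hook_gf q s = qgf q (hook_count s)"

text \<open>The closed form E_x / (1 - H). The series H has constant term 0, so 1 - H is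
  invertible.\<close>

definition word_gf :: "real \<Rightarrow> real \<Rightarrow> real \<Rightarrow> real fps" where
  "word_gf q s x = qgf q (\<lambda>n. x ^ n) * inverse (1 - hook_gf q s)"

lemma hook_gf_nth_0 [simp]: "fps_nth (hook_gf q s) 0 = 0"
  by (simp add: hook_gf_def qgf_def hook_count_def)

lemma word_gf_nth_0 [simp]: "fps_nth (word_gf q s x) 0 = 1"
  by (simp add: word_gf_def qgf_def)

lemma word_gf_mult: "word_gf q s x * (1 - hook_gf q s) = qgf q (\<lambda>n. x ^ n)"
  unfolding word_gf_def mult.assoc by (subst inverse_mult_eq_1) auto

lemma word_gf_hook_recursion: "word_gf q s x = qgf q (\<lambda>n. x ^ n) + word_gf q s x * hook_gf q s"
  using word_gf_mult[of q s x] by (simp add: algebra_simps)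

text \<open>The sum s + ... + s^n is s times 1 + ... + s^(n-1), and the latter is the n-th
  coefficient of E_1 - (1 - H). The powers \<open>1 ^ n\<close> give E_1 the form that
  \<open>word_gf_mult\<close> has at x = 1.\<close>

lemma qderiv_hook_gf:
  assumes "q > 0"
  shows "qderiv q (hook_gf q s) = fps_const s * (qgf q (\<lambda>n. 1 ^ n) - (1 - hook_gf q s))"
proof (rule qcoeff_eqI[OF assms])
  fix n
  have "hook_count s (Suc n) = s * (1 ^ n - ((if n = 0 then 1 else 0) - hook_count s n))"
    by (simp add: hook_count_def sum.lessThan_Suc_shift sum_distrib_left del: sum.lessThan_Suc)
  then show "qcoeff q (qderiv q (hook_gf q s)) n
      = qcoeff q (fps_const s * (qgf q (\<lambda>n. 1 ^ n) - (1 - hook_gf q s))) n"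
    using assms
    by (simp add: qcoeff_qderiv qcoeff_const_mult qcoeff_diff qcoeff_one qcoeff_qgf hook_gf_def)
qed

text \<open>Apply \<open>qderiv\<close> to W_x (1 - H) = E_x. Both D E_x = x E_x and D(1 - H) are
  multiples of 1 - H, which can be cancelled.\<close>

lemma qderiv_word_gf:
  assumes "q > 0"
  shows "qderiv q (word_gf q s x)
    = fps_const x * word_gf q s x + fps_const s * (qscale q (word_gf q s x) * (word_gf q s 1 - 1))"
proof -
  let ?W = "word_gf q s" and ?P = "1 - hook_gf q s"
  have "fps_const x * ?W x * ?P = qderiv q (qgf q (\<lambda>n. x ^ n))"
    unfolding mult.assoc word_gf_mult
    by (rule qcoeff_eqI[OF assms])
       (simp add: qcoeff_qderiv qcoeff_const_mult qcoeff_qgf assms)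
  also have "\<dots> = qderiv q (?W x) * ?P + qscale q (?W x) * qderiv q ?P"
    unfolding word_gf_mult[of q s x, symmetric] by (rule qderiv_mult)
  \<comment> \<open>Writing E_1 as W_1 (1 - H) exposes the common factor 1 - H.\<close>
  also have "qderiv q ?P = - (fps_const s * (?W 1 * ?P - ?P))"
    by (simp only: qderiv_diff qderiv_one qderiv_hook_gf[OF assms] word_gf_mult) simp
  finally have "qderiv q (?W x) * ?P
      = (fps_const x * ?W x + fps_const s * (qscale q (?W x) * (?W 1 - 1))) * ?P"
    by (simp add: algebra_simps)
  moreover have "?P \<noteq> 0"
  proof
    assume "?P = 0"
    then have "fps_nth ?P 0 = 0" by simp
    then show False by simp
  qed
  ultimately show ?thesis
    by simp
qed

section \<open>Inversions\<close>

lemma inv_stat_Cons: "inv_stat (x # w) = length (filter (\<lambda>y. y < x) w) + inv_stat w"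
proof -
  let ?A = "(\<lambda>j. (0, Suc j)) ` {j. j < length w \<and> w ! j < x}"
  let ?B = "map_prod Suc Suc ` inversion_set w"
  have "inversion_set (x # w) = ?A \<union> ?B"
  proof (intro equalityI subsetI)
    fix p assume "p \<in> inversion_set (x # w)"
    then obtain i j where "p = (i, j)" "i < j" "j < Suc (length w)" "(x # w) ! j < (x # w) ! i"
      by (auto simp: inversion_set_def)
    then show "p \<in> ?A \<union> ?B"
      by (cases i; cases j) (auto simp: inversion_set_def image_iff)
  qed (auto simp: inversion_set_def)
  moreover have "finite (inversion_set w)"
    by (rule finite_subset[of _ "{..<length w} \<times> {..<length w}"]) (auto simp: inversion_set_def)
  moreover have "card ?A = length (filter (\<lambda>y. y < x) w)"
    by (subst card_image) (auto simp: inj_on_def length_filter_conv_card)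
  moreover have "card ?B = inv_stat w"
    unfolding inv_stat_def by (intro card_image) (auto simp: inj_on_def)
  moreover have "?A \<inter> ?B = {}"
    by auto
  ultimately show ?thesis
    by (simp add: inv_stat_def card_Un_disjoint)
qed

lemma inv_stat_Nil [simp]: "inv_stat [] = 0"
  by (simp add: inv_stat_def inversion_set_def)

lemma inv_stat_sorted: "sorted w \<Longrightarrow> inv_stat w = 0"
  by (induction w) (auto simp: inv_stat_Cons filter_empty_conv not_less)

section \<open>Inversions across two blocks\<close>

lemma cross_inv_empty [simp]: "cross_inv {} V = 0" "cross_inv U {} = 0"
  by (simp_all add: cross_inv_def)

lemma cross_inv_insert_left:
  assumes "finite U" "finite V" "x \<notin> U"
  shows "cross_inv (insert x U) V = card {v \<in> V. v < x} + cross_inv U V"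
proof -
  let ?A = "Pair x ` {v \<in> V. v < x}" and ?B = "{(u, v). u \<in> U \<and> v \<in> V \<and> v < u}"
  have "{(u, v). u \<in> insert x U \<and> v \<in> V \<and> v < u} = ?A \<union> ?B"
    by auto
  moreover have "finite ?B"
    by (rule finite_subset[of _ "U \<times> V"]) (use assms in auto)
  moreover have "card ?A = card {v \<in> V. v < x}"
    by (intro card_image) (auto simp: inj_on_def)
  moreover have "?A \<inter> ?B = {}"
    using assms by auto
  ultimately show ?thesis
    using assms by (simp add: cross_inv_def card_Un_disjoint)
qed

lemma inv_stat_append:
  assumes "distinct u" "distinct v"
  shows "inv_stat (u @ v) = inv_stat u + inv_stat v + cross_inv (set u) (set v)"
  using assms(1)
proof (induction u)
  case (Cons x u)
  have "length (filter (\<lambda>y. y < x) v) = card {y \<in> set v. y < x}"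
    using assms(2) by (simp add: distinct_length_filter Int_def conj_commute)
  then show ?case
    using Cons by (simp add: inv_stat_Cons cross_inv_insert_left)
qed simp

text \<open>Links \<open>ai\<close>, which counts positions, to \<open>cross_inv\<close>, which
  counts letters; distinctness makes the passage from positions to letters injective.\<close>

lemma card_inverted_positions:
  assumes "distinct u" "distinct v"
  shows "card {(i, j). i < length u \<and> j < length v \<and> v ! j < u ! i} = cross_inv (set u) (set v)"
proof -
  let ?A = "{(i, j). i < length u \<and> j < length v \<and> v ! j < u ! i}"
  let ?f = "map_prod ((!) u) ((!) v)"
  have "?f ` ?A = {(x, y). x \<in> set u \<and> y \<in> set v \<and> y < x}"
  proof (intro equalityI subsetI)
    fix p assume "p \<in> {(x, y). x \<in> set u \<and> y \<in> set v \<and> y < x}"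
    then obtain i j where "p = (u ! i, v ! j)" "i < length u" "j < length v" "v ! j < u ! i"
      by (auto simp: in_set_conv_nth)
    then show "p \<in> ?f ` ?A"
      by (intro image_eqI[of _ _ "(i, j)"]) auto
  qed auto
  then have "cross_inv (set u) (set v) = card (?f ` ?A)"
    by (simp only: cross_inv_def)
  also have "\<dots> = card ?A"
    using assms by (intro card_image) (auto simp: inj_on_def nth_eq_iff_index_eq)
  finally show ?thesis ..
qed

section \<open>Cutting at the smallest letter\<close>

text \<open>Inversions are classified by the blocks containing their ends. Inside \<open>u\<close>
  and \<open>v\<close> admissibility is unchanged. From \<open>u\<close> to \<open>v\<close> every
  inversion is admissible, since the smaller letter \<open>m\<close> stands in between. Those ending
  at \<open>m\<close> have nothing smaller in between, so all are admissible if a letter follows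
  \<open>m\<close> and none otherwise.\<close>

lemma ai_split_at_min:
  assumes "distinct u" "distinct v" "\<forall>x\<in>set u. m < x" "\<forall>x\<in>set v. m < x"
  shows "ai (u @ m # v) =
    ai u + ai v + cross_inv (set u) (set v) + (if v = [] then 0 else length u)"
proof -
  let ?w = "u @ m # v" and ?a = "length u"
  let ?s = "\<lambda>j. Suc (?a + j)"
  let ?I = "\<lambda>w. {p \<in> inversion_set w. admissible w p}"
  let ?M = "if v = [] then {} else (\<lambda>i. (i, ?a)) ` {..<?a}"
  let ?X = "{(i, j). i < length u \<and> j < length v \<and> v ! j < u ! i}"
  have nth: "i < ?a \<Longrightarrow> ?w ! i = u ! i" "?w ! ?a = m" "?w ! (?s j) = v ! j" for i j
    by (auto simp: nth_append)
  have mu: "m < u ! i" if "i < ?a" for i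
    using that assms(3) by simp
  have mv: "m < v ! i" if "i < length v" for i
    using that assms(4) by simp
  have 1: "(i, j) \<in> ?I ?w \<longleftrightarrow> (i, j) \<in> ?I u" if "j < ?a" for i j
  proof -
    have "(\<exists>k. i < k \<and> k < j \<and> ?w ! k < ?w ! j) \<longleftrightarrow> (\<exists>k. i < k \<and> k < j \<and> u ! k < u ! j)"
      using that by (auto simp: nth(1))
    \<comment> \<open>The last letter of \<open>u\<close> is followed by the smaller
      \<open>m\<close>, so this alternative fails for it in the long word as it does in
      \<open>u\<close>.\<close>
    moreover have "?w ! j < ?w ! Suc j \<longleftrightarrow> Suc j < ?a \<and> u ! j < u ! Suc j"
    proof (cases "Suc j = ?a")
      case True
      then have "?w ! Suc j = m"
        using nth(2) by metis
      then show ?thesis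
        using True mu[OF that] nth(1)[OF that] by simp
    next
      case False
      then show ?thesis
        using that by (auto simp: nth(1))
    qed
    ultimately show ?thesis
      using that by (auto simp: inversion_set_def admissible_def nth(1))
  qed
  have 2: "(i, ?a) \<in> ?I ?w \<longleftrightarrow> i < ?a \<and> v \<noteq> []" for i
  proof (cases "i < ?a")
    case True
    have "\<not> (\<exists>k. i < k \<and> k < ?a \<and> ?w ! k < ?w ! ?a)"
      unfolding nth(2) using mu nth(1) by (metis not_less_iff_gr_or_eq)
    moreover have "Suc ?a < length ?w \<and> ?w ! ?a < ?w ! Suc ?a \<longleftrightarrow> v \<noteq> []"
      using nth(3)[of 0] mv[of 0] unfolding nth(2) by auto
    moreover have "(i, ?a) \<in> inversion_set ?w"
      using True mu[OF True] nth(1)[OF True] nth(2) by (simp add: inversion_set_def)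
    ultimately show ?thesis
      using True unfolding admissible_def by blast
  qed (auto simp: inversion_set_def)
  have 3: "(i, ?s j) \<in> ?I ?w \<longleftrightarrow> j < length v \<and> v ! j < u ! i" if "i < ?a" for i j
  proof -
    have "\<exists>k. i < k \<and> k < ?s j \<and> ?w ! k < ?w ! (?s j)" if "j < length v"
      using that \<open>i < ?a\<close> nth(2) nth(3)[of j] mv[of j] by (intro exI[of _ ?a]) auto
    then show ?thesis
      using that nth(3)[of j] nth(1)[of i] by (auto simp: inversion_set_def admissible_def)
  qed
  have 4: "(?a, ?s j) \<notin> ?I ?w" for j
    using mv[of j] nth(2) nth(3)[of j] by (auto simp: inversion_set_def)
  have 5: "(?s i, ?s j) \<in> ?I ?w \<longleftrightarrow> (i, j) \<in> ?I v" for i j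
  proof -
    have "(\<exists>k. ?s i < k \<and> k < ?s j \<and> ?w ! k < ?w ! (?s j)) \<longleftrightarrow> (\<exists>k. i < k \<and> k < j \<and> v ! k < v ! j)"
    proof
      assume "\<exists>k. ?s i < k \<and> k < ?s j \<and> ?w ! k < ?w ! (?s j)"
      then obtain k where k: "?s i < k" "k < ?s j" "?w ! k < ?w ! (?s j)"
        by blast
      then have "k = ?s (k - Suc ?a)"
        by simp
      then show "\<exists>k. i < k \<and> k < j \<and> v ! k < v ! j"
        using k nth(3) by (metis Suc_less_eq add_less_cancel_left)
    next
      assume "\<exists>k. i < k \<and> k < j \<and> v ! k < v ! j"
      then show "\<exists>k. ?s i < k \<and> k < ?s j \<and> ?w ! k < ?w ! (?s j)"
        using nth(3) by (metis Suc_less_eq add_less_cancel_left)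
    qed
    moreover have "?w ! Suc (?s j) = v ! Suc j"
      using nth(3)[of "Suc j"] by simp
    ultimately show ?thesis
      using nth(3)[of i] nth(3)[of j] by (auto simp: inversion_set_def admissible_def)
  qed
  have eq: "?I ?w = ?I u \<union> ?M \<union> map_prod id ?s ` ?X \<union> map_prod ?s ?s ` ?I v" (is "_ = ?R")
  proof (intro set_eqI)
    fix p
    obtain i j :: nat where p: "p = (i, j)"
      by fastforce
    consider "j < ?a" | "j = ?a" | j' where "j = ?s j'" "i < ?a"
      | j' where "j = ?s j'" "i = ?a" | i' j' where "j = ?s j'" "i = ?s i'"
      by (metis less_iff_Suc_add linorder_less_linear)
    then show "p \<in> ?I ?w \<longleftrightarrow> p \<in> ?R"
    proof cases
      case 1
      then show ?thesis
        using \<open>j < ?a \<Longrightarrow> (i, j) \<in> ?I ?w \<longleftrightarrow> (i, j) \<in> ?I u\<close>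
        unfolding p by (auto simp: image_iff)
    next
      case 2
      then show ?thesis
        using \<open>(i, ?a) \<in> ?I ?w \<longleftrightarrow> i < ?a \<and> v \<noteq> []\<close>
        unfolding p by (auto simp: image_iff inversion_set_def)
    next
      case (3 j')
      then show ?thesis
        using \<open>i < ?a \<Longrightarrow> (i, ?s j') \<in> ?I ?w \<longleftrightarrow> j' < length v \<and> v ! j' < u ! i\<close>
        unfolding p by (auto simp: image_iff inversion_set_def)
    next
      case (4 j')
      then show ?thesis
        using \<open>(?a, ?s j') \<notin> ?I ?w\<close>
        unfolding p by (auto simp: image_iff inversion_set_def)
    next
      case (5 i' j')
      then show ?thesis
        using \<open>(?s i', ?s j') \<in> ?I ?w \<longleftrightarrow> (i', j') \<in> ?I v\<close>
        unfolding p by (auto simp: image_iff inversion_set_def)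
    qed
  qed
  have fin: "finite (?I w)" for w :: "'a list"
    by (rule finite_subset[of _ "{..<length w} \<times> {..<length w}"]) (auto simp: inversion_set_def)
  have finX: "finite ?X"
    by (rule finite_subset[of _ "{..<length u} \<times> {..<length v}"]) auto
  have "card ?R = card (?I u) + card ?M + card (map_prod id ?s ` ?X) + card (map_prod ?s ?s ` ?I v)"
    using fin finX
    by (subst card_Un_disjoint; (subst card_Un_disjoint; (subst card_Un_disjoint)?)?)
       (auto simp: inversion_set_def)
  moreover have "card ?M = (if v = [] then 0 else length u)"
    by (auto simp: card_image inj_on_def)
  moreover have "card (map_prod id ?s ` ?X) = cross_inv (set u) (set v)"
    unfolding card_inverted_positions[OF assms(1,2), symmetric]
    by (intro card_image) (auto simp: inj_on_def)
  moreover have "card (map_prod ?s ?s ` ?I v) = card (?I v)"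
    by (intro card_image) (auto simp: inj_on_def)
  ultimately show ?thesis
    unfolding ai_def eq by simp
qed

section \<open>Descents and \<open>aix\<close> at the cut\<close>

lemma des_Cons: "des (x # w) = (if w \<noteq> [] \<and> hd w < x then 1 else 0) + des w"
proof -
  let ?D = "\<lambda>w. {i. Suc i < length w \<and> w ! Suc i < w ! i}"
  have "?D (x # w) = (if w \<noteq> [] \<and> hd w < x then {0} else {}) \<union> Suc ` ?D w" (is "_ = ?A \<union> ?B")
  proof (intro set_eqI)
    fix i show "i \<in> ?D (x # w) \<longleftrightarrow> i \<in> ?A \<union> ?B"
      by (cases i) (auto simp: hd_conv_nth)
  qed
  moreover have "finite (?D w)"
    by (rule finite_subset[of _ "{..<length w}"]) auto
  then have "card (?A \<union> ?B) = card ?A + card ?B"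
    by (intro card_Un_disjoint) auto
  moreover have "card ?B = card (?D w)"
    by (intro card_image) auto
  ultimately show ?thesis
    by (simp add: des_def)
qed

lemma des_Nil [simp]: "des [] = 0"
  by (simp add: des_def)

lemma ai_Nil [simp]: "ai [] = 0"
  by (simp add: ai_def inversion_set_def)

lemma aix_Nil [simp]: "aix [] = 0"
  by (subst aix.simps) simp

lemma des_split_at_min:
  assumes "\<forall>x\<in>set u. m < x" "\<forall>x\<in>set v. m < x"
  shows "des (u @ m # v) = des u + des v + (if u = [] then 0 else 1)"
  using assms(1)
proof (induction u)
  case Nil
  have "v \<noteq> [] \<Longrightarrow> \<not> hd v < m"
    using assms(2) by (metis hd_in_set not_less_iff_gr_or_eq)
  then show ?case
    by (auto simp: des_Cons)
next
  case (Cons x u)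
  then show ?case
    by (cases u) (auto simp: des_Cons)
qed

lemma aix_split_at_min:
  assumes "\<forall>x\<in>set u. m < x" "\<forall>x\<in>set v. m < x"
  shows "aix (u @ m # v) = (if u = [] then 1 + aix v else if v = [] then 0 else aix u)"
proof -
  have "Min (set (u @ m # v)) = m"
    using assms by (intro Min_eqI) auto
  moreover have "takeWhile (\<lambda>x. x \<noteq> m) (u @ m # v) = u"
    using assms by (subst takeWhile_append2) auto
  moreover have "dropWhile (\<lambda>x. x \<noteq> m) (u @ m # v) = m # v"
    using assms by (subst dropWhile_append2) auto
  ultimately show ?thesis
    by (subst aix.simps)
       (simp only: Let_def list.sel append_is_Nil_conv list.distinct simp_thms if_False)
qed

section \<open>The recursion for (aix, des, aid)\<close>

lemma sum_permutations_insert: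
  fixes F :: "'a list \<Rightarrow> 'b::comm_monoid_add"
  assumes "finite S" "m \<notin> S"
  shows "(\<Sum>w\<in>permutations_of_set (insert m S). F w) =
    (\<Sum>U\<in>Pow S. \<Sum>u\<in>permutations_of_set U. \<Sum>v\<in>permutations_of_set (S - U). F (u @ m # v))"
proof -
  let ?T = "Sigma (Pow S) (\<lambda>U. permutations_of_set U \<times> permutations_of_set (S - U))"
  have bij: "bij_betw (\<lambda>(U, u, v). u @ m # v) ?T (permutations_of_set (insert m S))"
  proof (rule bij_betw_imageI)
    show "inj_on (\<lambda>(U, u, v). u @ m # v) ?T"
    proof (rule inj_onI)
      fix p p'
      assume p: "p \<in> ?T" "p' \<in> ?T"
        and eq: "(case p of (U, u, v) \<Rightarrow> u @ m # v) = (case p' of (U, u, v) \<Rightarrow> u @ m # v)"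
      obtain U u v U' u' v' where pp: "p = (U, u, v)" "p' = (U', u', v')"
        by (metis surj_pair)
      \<comment> \<open>\<open>m\<close> occurs in neither \<open>u\<close> nor \<open>v\<close>, so
        the word determines the place of the cut, and U is the set of letters to its left.\<close>
      have "set u = U" "set u' = U'" "set u \<subseteq> S" "set v \<subseteq> S"
        using p by (auto simp: pp permutations_of_set_def)
      then show "p = p'"
        using eq assms(2) append_Cons_eq_iff[of m u v u' v'] by (auto simp: pp)
    qed
    show "(\<lambda>(U, u, v). u @ m # v) ` ?T = permutations_of_set (insert m S)"
    proof (intro equalityI subsetI)
      fix w assume "w \<in> (\<lambda>(U, u, v). u @ m # v) ` ?T"
      then show "w \<in> permutations_of_set (insert m S)"
        using assms by (auto simp: permutations_of_set_def)
    next
      fix w assume w: "w \<in> permutations_of_set (insert m S)"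
      then obtain u v where uv: "w = u @ m # v"
        by (metis insertI1 permutations_of_setD(1) split_list)
      then have "set u \<union> set v = S" "set u \<inter> set v = {}" "distinct u" "distinct v"
        using w assms by (auto simp: permutations_of_set_def)
      then show "w \<in> (\<lambda>(U, u, v). u @ m # v) ` ?T"
        using uv by (intro image_eqI[of _ _ "(set u, u, v)"]) (auto simp: permutations_of_set_def)
    qed
  qed
  have "(\<Sum>w\<in>permutations_of_set (insert m S). F w) = (\<Sum>(U, u, v)\<in>?T. F (u @ m # v))"
    using sum.reindex_bij_betw[OF bij, of F] by (simp add: case_prod_unfold)
  also have "\<dots> = (\<Sum>U\<in>Pow S.
      \<Sum>(u, v)\<in>permutations_of_set U \<times> permutations_of_set (S - U). F (u @ m # v))"
    using assms(1) by (subst sum.Sigma) (auto simp: finite_subset)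
  finally show ?thesis
    by (simp add: sum.cartesian_product)
qed

text \<open>Arbitrary letter sets are allowed because the blocks left by a cut need not be initial
  segments.\<close>

definition aix_sum :: "real \<Rightarrow> real \<Rightarrow> real \<Rightarrow> 'a::linorder set \<Rightarrow> real" where
  "aix_sum q t x S = (\<Sum>w\<in>permutations_of_set S. x ^ aix w * t ^ des w * q ^ aid w)"

lemma aix_sum_empty [simp]: "aix_sum q t x {} = 1"
  by (simp add: aix_sum_def aid_def)

text \<open>With an empty left block \<open>m\<close> counts for \<open>aix\<close>. Otherwise the
  descent into \<open>m\<close> counts in both \<open>des\<close> and \<open>aid\<close>, giving
  \<open>t * q\<close>. A word ending in \<open>m\<close> has \<open>aix\<close> 0, and in the
  remaining case \<open>aix\<close> ignores the right block, so x becomes 1 for the ignored letters;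
  there the \<open>card U\<close> inversions ending at \<open>m\<close> are admissible.\<close>

lemma aix_sum_insert_min:
  fixes S :: "'a::linorder set"
  assumes "finite S" "\<forall>y\<in>S. m < y"
  shows "aix_sum q t x (insert m S) =
    (\<Sum>U\<in>Pow S. if U = {} then x * aix_sum q t x S
      else if U = S then t * q * aix_sum q t 1 S
      else t * q * q ^ cross_inv U (S - U) * q ^ card U * aix_sum q t x U * aix_sum q t 1 (S - U))"
proof -
  let ?wt = "\<lambda>x w. x ^ aix w * t ^ des w * q ^ aid w"
  have m: "m \<notin> S"
    using assms by auto
  show ?thesis
    unfolding aix_sum_def[of q t x "insert m S"] sum_permutations_insert[OF assms(1) m]
  proof (intro sum.cong refl)
    fix U assume U: "U \<in> Pow S"
    let ?V = "S - U"
    have less: "\<forall>y\<in>U. m < y" "\<forall>y\<in>?V. m < y"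
      using U assms by auto
    show "(\<Sum>u\<in>permutations_of_set U. \<Sum>v\<in>permutations_of_set ?V. ?wt x (u @ m # v)) =
      (if U = {} then x * aix_sum q t x S
      else if U = S then t * q * aix_sum q t 1 S
      else t * q * q ^ cross_inv U ?V * q ^ card U * aix_sum q t x U * aix_sum q t 1 ?V)"
      (is "?lhs = _")
    proof -
      consider "U = {}" | "U \<noteq> {}" "U = S" | "U \<noteq> {}" "?V \<noteq> {}"
        using U by auto
      then show ?thesis
      proof cases
        case 1
        have "?wt x ([] @ m # v) = x * ?wt x v" if "v \<in> permutations_of_set S" for v
        proof -
          have "set v = S" "distinct v"
            using that by (auto simp: permutations_of_set_def)
          then show ?thesis
            using assms aix_split_at_min[where u = "[]" and m = m and v = v]
              des_split_at_min[where u = "[]" and m = m and v = v]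
              ai_split_at_min[where u = "[]" and m = m and v = v]
            by (simp add: aid_def del: append_Nil)
        qed
        then show ?thesis
          using 1 by (simp add: aix_sum_def sum_distrib_left)
      next
        case 2
        have "?wt x (u @ [m]) = t * q * ?wt 1 u" if "u \<in> permutations_of_set S" for u
        proof -
          have "set u = S" "distinct u" "u \<noteq> []"
            using that 2 by (auto simp: permutations_of_set_def)
          then show ?thesis
            using assms aix_split_at_min[where u = u and m = m and v = "[]"]
              des_split_at_min[where u = u and m = m and v = "[]"]
              ai_split_at_min[where u = u and m = m and v = "[]"]
            by (simp add: aid_def power_add)
        qed
        then show ?thesis
          using 2 by (simp add: aix_sum_def sum_distrib_left)
      next
        case 3
        have "?lhs = (\<Sum>u\<in>permutations_of_set U. \<Sum>v\<in>permutations_of_set ?V.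
            t * q * q ^ cross_inv U ?V * q ^ card U * (?wt x u * ?wt 1 v))"
        proof (intro sum.cong refl)
          fix u v assume uv: "u \<in> permutations_of_set U" "v \<in> permutations_of_set ?V"
          then have "set u = U" "distinct u" "u \<noteq> []" "set v = ?V" "distinct v" "v \<noteq> []"
            using 3 by (auto simp: permutations_of_set_def)
          moreover have "length u = card U"
            using calculation by (metis distinct_card)
          ultimately show "?wt x (u @ m # v)
              = t * q * q ^ cross_inv U ?V * q ^ card U * (?wt x u * ?wt 1 v)"
            using less aix_split_at_min[where u = u and m = m and v = v]
              des_split_at_min[where u = u and m = m and v = v]
              ai_split_at_min[where u = u and m = m and v = v]
            by (simp add: aid_def power_add mult_ac)
        qed
        also have "\<dots> = t * q * q ^ cross_inv U ?V * q ^ card U * (aix_sum q t x U * aix_sum q t 1 ?V)"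
          unfolding aix_sum_def sum_product by (simp add: sum_distrib_left)
        finally show ?thesis
          using 3 by auto
      qed
    qed
  qed
qed

text \<open>Removing the smallest letter corresponds to \<open>qderiv\<close>, and
  \<open>qderiv_word_gf\<close> expands into a sum over subsets. The parameter x is generalised
  because right blocks carry the value 1.\<close>

lemma aix_sum_eq_qcoeff:
  fixes S :: "'a::linorder set"
  assumes "q > 0" "finite S"
  shows "aix_sum q t x S = qcoeff q (word_gf q (t * q) x) (card S)"
  using assms(2)
proof (induction "card S" arbitrary: S x rule: less_induct)
  case less
  let ?W = "word_gf q (t * q)"
  show ?case
  proof (cases "S = {}")
    case True
    then show ?thesis by simp
  next
    case False
    define m where "m = Min S"
    define S' where "S' = S - {m}"
    have "m \<in> S"
      using Min_in[OF less.prems False] by (simp add: m_def)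
    then have S: "S = insert m S'" "m \<notin> S'" "finite S'" "card S = Suc (card S')"
      using less.prems card.remove[of S m] unfolding S'_def by auto
    have m: "\<forall>y\<in>S'. m < y"
      using less.prems by (auto simp: m_def S'_def less_le)
    have IH: "aix_sum q t y U = qcoeff q (?W y) (card U)" if "U \<subseteq> S'" for U y
      using that S by (intro less.hyps) (auto simp: less_Suc_eq_le card_mono finite_subset)
    define T where "T U = (if U = {} then x * aix_sum q t x S'
      else if U = S' then t * q * aix_sum q t 1 S'
      else t * q * q ^ cross_inv U (S' - U) * q ^ card U * aix_sum q t x U * aix_sum q t 1 (S' - U))"
      for U
    define R where "R U = t * q * (q ^ cross_inv U (S' - U) * qcoeff q (qscale q (?W x)) (card U)
        * qcoeff q (?W 1 - 1) (card (S' - U)))" for U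
    txt \<open>
      \<open>T\<close> and \<open>R\<close> agree off the two trivial subsets, where \<open>T S' = R {}\<close> and \<open>R S' = 0\<close>.
    \<close>
    have "(\<Sum>U\<in>Pow S'. T U) = x * qcoeff q (?W x) (card S') + (\<Sum>U\<in>Pow S'. R U)"
    proof (cases "S' = {}")
      \<comment> \<open>The two trivial subsets coincide here, and W_1 - 1 has constant term
        0.\<close>
      case True
      then show ?thesis
        by (simp add: T_def R_def qcoeff_diff qcoeff_one)
    next
      case False
      \<comment> \<open>The block \<open>S' - U\<close> is nonempty, so subtracting 1 from W_1 does
        not affect its coefficient; \<open>qscale\<close> supplies
        \<open>q ^ card U\<close>.\<close>
      have "T U = R U" if "U \<in> Pow S' - {{}, S'}" for U
      proof -
        have "card (S' - U) \<noteq> 0"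
          using that S by auto
        then show ?thesis
          using that IH[of U] IH[of "S' - U"]
          by (simp add: T_def R_def qcoeff_diff qcoeff_one qcoeff_qscale)
      qed
      then have "(\<Sum>U\<in>Pow S' - {{}, S'}. T U) = (\<Sum>U\<in>Pow S' - {{}, S'}. R U)"
        by (intro sum.cong) auto
      moreover have "(\<Sum>U\<in>Pow S'. f U) = f {} + f S' + (\<Sum>U\<in>Pow S' - {{}, S'}. f U)"
        for f :: "'a set \<Rightarrow> real"
      proof -
        have "(\<Sum>U\<in>Pow S'. f U) = (\<Sum>U\<in>Pow S' - {{}, S'}. f U) + (\<Sum>U\<in>{{}, S'}. f U)"
          using S by (intro sum.subset_diff) auto
        then show ?thesis
          using False by simp
      qed
      moreover have "card S' \<noteq> 0"
        using False S by auto
      ultimately show ?thesis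
        using False IH[of S']
        by (simp add: T_def R_def qcoeff_diff qcoeff_one qcoeff_qscale)
    qed
    moreover have "aix_sum q t x S = (\<Sum>U\<in>Pow S'. T U)"
      unfolding S(1) T_def by (rule aix_sum_insert_min[OF S(3) m])
    moreover have "qcoeff q (?W x) (card S)
        = x * qcoeff q (?W x) (card S') + (\<Sum>U\<in>Pow S'. R U)"
      unfolding S(4) qcoeff_qderiv[symmetric] qderiv_word_gf[OF assms(1)] qcoeff_add qcoeff_const_mult
      by (simp add: qcoeff_mult_Pow[OF S(3)] R_def sum_distrib_left)
    ultimately show ?thesis
      by simp
  qed
qed

section \<open>Removing the last hook\<close>

lemma is_hook_factorization_hook_factorization: "is_hook_factorization w (hook_factorization w)"
  unfolding hook_factorization_def by (rule theI'[OF hook_factorization_ex1])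

lemma hook_factorization_eqI: "is_hook_factorization w p \<Longrightarrow> hook_factorization w = p"
  unfolding hook_factorization_def by (rule the1_equality[OF hook_factorization_ex1])

lemma hook_factorization_sorted: "sorted w \<Longrightarrow> hook_factorization w = (w, [])"
  by (rule hook_factorization_eqI) (simp add: is_hook_factorization_def)

text \<open>Extending the factorization of \<open>w\<close> by \<open>h\<close> gives a hook
  factorization of \<open>w @ h\<close>, and there is only one.\<close>

lemma hook_factorization_append_hook:
  assumes "hook h"
  shows "hook_factorization (w @ h) =
    (fst (hook_factorization w), snd (hook_factorization w) @ [h])"
  using is_hook_factorization_hook_factorization[of w] assms
  by (intro hook_factorization_eqI)
     (cases "hook_factorization w", auto simp: is_hook_factorization_def)

lemma hook_factorization_cases:
  obtains "sorted w" | v h where "w = v @ h" "hook h"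
proof -
  obtain w0 hs where w: "is_hook_factorization w (w0, hs)"
    using is_hook_factorization_hook_factorization[of w] by (cases "hook_factorization w") auto
  show ?thesis
  proof (cases hs rule: rev_cases)
    case Nil
    then show ?thesis
      using w that(1) by (simp add: is_hook_factorization_def)
  next
    case (snoc hs' h)
    then show ?thesis
      using w that(2)[of "w0 @ concat hs'" h] by (simp add: is_hook_factorization_def)
  qed
qed

lemma not_sorted_append_hook: "hook h \<Longrightarrow> \<not> sorted (v @ h)"
  by (cases h; cases "tl h") (auto simp: hook_def sorted_append)

text \<open>The hook cut off at the end is the last one of the unique factorization, hence
  determined by the word.\<close>

lemma append_hook_eq_iff:
  assumes "hook h" "hook h'"
  shows "w @ h = w' @ h' \<longleftrightarrow> w = w' \<and> h = h'"
  using hook_factorization_append_hook[OF assms(1), of w]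
    hook_factorization_append_hook[OF assms(2), of w'] by auto

lemma sum_permutations_last_hook:
  fixes F :: "'a::linorder list \<Rightarrow> 'b::comm_monoid_add"
  assumes "finite S"
  shows "(\<Sum>w\<in>permutations_of_set S. F w) = F (sorted_list_of_set S) +
    (\<Sum>U\<in>Pow S. \<Sum>w\<in>permutations_of_set U. \<Sum>h\<in>{h \<in> permutations_of_set (S - U). hook h}. F (w @ h))"
proof -
  let ?P = "permutations_of_set S"
  let ?H = "\<lambda>U. {h \<in> permutations_of_set (S - U). hook h}"
  let ?T = "Sigma (Pow S) (\<lambda>U. permutations_of_set U \<times> ?H U)"
  have sorted: "{w \<in> ?P. sorted w} = {sorted_list_of_set S}"
    using assms by (auto simp: permutations_of_set_def sorted_list_of_set.idem_if_sorted_distinct)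
  have bij: "bij_betw (\<lambda>(U, w, h). w @ h) ?T {w \<in> ?P. \<not> sorted w}"
  proof (rule bij_betw_imageI)
    show "inj_on (\<lambda>(U, w, h). w @ h) ?T"
      by (auto simp: inj_on_def append_hook_eq_iff permutations_of_set_def)
    show "(\<lambda>(U, w, h). w @ h) ` ?T = {w \<in> ?P. \<not> sorted w}"
    proof (intro equalityI subsetI)
      fix w assume "w \<in> (\<lambda>(U, w, h). w @ h) ` ?T"
      then show "w \<in> {w \<in> ?P. \<not> sorted w}"
        by (auto simp: permutations_of_set_def not_sorted_append_hook)
    next
      fix w assume w: "w \<in> {w \<in> ?P. \<not> sorted w}"
      then obtain v h where "w = v @ h" "hook h"
        using hook_factorization_cases[of w] by auto
      then show "w \<in> (\<lambda>(U, w, h). w @ h) ` ?T"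
        using w by (intro image_eqI[of _ _ "(set v, v, h)"]) (auto simp: permutations_of_set_def)
    qed
  qed
  have "?P = {w \<in> ?P. sorted w} \<union> {w \<in> ?P. \<not> sorted w}"
    by auto
  then have "(\<Sum>w\<in>?P. F w) = (\<Sum>w\<in>{w \<in> ?P. sorted w} \<union> {w \<in> ?P. \<not> sorted w}. F w)"
    by (rule arg_cong)
  also have "\<dots> = (\<Sum>w\<in>{w \<in> ?P. sorted w}. F w) + (\<Sum>w\<in>{w \<in> ?P. \<not> sorted w}. F w)"
    by (intro sum.union_disjoint) auto
  also have "(\<Sum>w\<in>{w \<in> ?P. \<not> sorted w}. F w) = (\<Sum>(U, w, h)\<in>?T. F (w @ h))"
    using sum.reindex_bij_betw[OF bij, of F] by (simp add: case_prod_unfold)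
  also have "\<dots> = (\<Sum>U\<in>Pow S. \<Sum>(w, h)\<in>permutations_of_set U \<times> ?H U. F (w @ h))"
    using assms by (subst sum.Sigma) (auto simp: finite_subset)
  finally show ?thesis
    by (simp add: sorted sum.cartesian_product)
qed

text \<open>The ranks in V are 0, ..., \<open>card V\<close> - 1, each once: a new maximum changes
  no old rank and adds the next one.\<close>

lemma sum_power_rank:
  fixes s :: real and V :: "'a::linorder set"
  assumes "finite V"
  shows "(\<Sum>y\<in>V. s ^ card {v \<in> V. v < y}) = (\<Sum>j<card V. s ^ j)"
  using assms
proof (induction V rule: finite_linorder_max_induct)
  case (insert b A)
  have "b \<notin> A"
    using insert.hyps by auto
  moreover have "{v \<in> insert b A. v < b} = A"
    using insert.hyps by auto
  moreover have "(\<Sum>y\<in>A. s ^ card {v \<in> insert b A. v < y}) = (\<Sum>y\<in>A. s ^ card {v \<in> A. v < y})"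
  proof (intro sum.cong refl)
    fix y assume "y \<in> A"
    then have "{v \<in> insert b A. v < y} = {v \<in> A. v < y}"
      using insert.hyps by auto
    then show "s ^ card {v \<in> insert b A. v < y} = s ^ card {v \<in> A. v < y}"
      by simp
  qed
  ultimately show ?case
    using insert by simp
qed simp

text \<open>A hook is determined by its first letter, which can be any letter of V but the minimum.
  The rest is increasing, so the number of inversions is the rank of that letter.\<close>

lemma sum_hooks:
  fixes V :: "'a::linorder set"
  assumes "finite V"
  shows "(\<Sum>h\<in>{h \<in> permutations_of_set V. hook h}. s ^ inv_stat h) = hook_count s (card V)"
proof (cases "V = {}")
  \<comment> \<open>The empty word is no hook, which is why \<open>hook_count\<close> is 0 here; its
    general formula would give -1.\<close>
  case True
  then show ?thesis
    by (auto simp: hook_count_def hook_def)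
next
  case False
  let ?h = "\<lambda>y. y # sorted_list_of_set (V - {y})"
  let ?N = "{y \<in> V. y \<noteq> Min V}"
  have hd_less_iff: "t \<noteq> [] \<and> hd t < y \<longleftrightarrow> (\<exists>v\<in>set t. v < y)" if "sorted t" for t and y :: 'a
    using that by (cases t) auto
  have hook_iff: "hook (?h y) \<longleftrightarrow> y \<noteq> Min V" if "y \<in> V" for y
  proof -
    have "hook (?h y) \<longleftrightarrow> (\<exists>v\<in>V. v < y)"
      using hd_less_iff[of "sorted_list_of_set (V - {y})" y] assms by (auto simp: hook_Cons_iff)
    also have "\<dots> \<longleftrightarrow> y \<noteq> Min V"
      using assms False that by (metis Min_in Min_le leD order.not_eq_order_implies_strict)
    finally show ?thesis .
  qed
  have "bij_betw ?h ?N {h \<in> permutations_of_set V. hook h}"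
  proof (rule bij_betw_imageI)
    show "inj_on ?h ?N"
      by (simp add: inj_on_def)
    show "?h ` ?N = {h \<in> permutations_of_set V. hook h}"
    proof (intro equalityI subsetI)
      fix h assume "h \<in> ?h ` ?N"
      then show "h \<in> {h \<in> permutations_of_set V. hook h}"
        using assms hook_iff by (auto simp: permutations_of_set_def)
    next
      fix h assume h: "h \<in> {h \<in> permutations_of_set V. hook h}"
      then obtain y t where yt: "h = y # t"
        by (cases h) (auto simp: hook_def)
      then have "sorted t" "distinct t" "set t = V - {y}" "y \<in> V"
        using h by (auto simp: hook_Cons_iff permutations_of_set_def)
      then have "h = ?h y"
        using yt sorted_list_of_set.idem_if_sorted_distinct[of t] by simp
      then show "h \<in> ?h ` ?N"
        using h hook_iff[of y] \<open>y \<in> V\<close> by blast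
    qed
  qed
  then have "(\<Sum>h\<in>{h \<in> permutations_of_set V. hook h}. s ^ inv_stat h)
      = (\<Sum>y\<in>?N. s ^ inv_stat (?h y))"
    by (rule sum.reindex_bij_betw[symmetric])
  also have "\<dots> = (\<Sum>y\<in>?N. s ^ card {v \<in> V. v < y})"
  proof (intro sum.cong refl)
    fix y assume "y \<in> ?N"
    have "{v. v < y} \<inter> (V - {y}) = {v \<in> V. v < y}"
      by auto
    then show "s ^ inv_stat (?h y) = s ^ card {v \<in> V. v < y}"
      using assms by (simp add: inv_stat_Cons inv_stat_sorted distinct_length_filter)
  qed
  \<comment> \<open>The excluded minimum has rank 0 and accounts for the 1.\<close>
  also have "\<dots> = (\<Sum>y\<in>V. s ^ card {v \<in> V. v < y}) - 1"
  proof -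
    have "V - {Min V} = ?N"
      by auto
    then have "(\<Sum>y\<in>V. s ^ card {v \<in> V. v < y})
        = s ^ card {v \<in> V. v < Min V} + (\<Sum>y\<in>?N. s ^ card {v \<in> V. v < y})"
      using sum.remove[OF assms Min_in[OF assms False]] by simp
    moreover have "{v \<in> V. v < Min V} = {}"
      using assms by (auto simp: leD)
    ultimately show ?thesis
      by simp
  qed
  finally show ?thesis
    using assms False by (simp add: sum_power_rank hook_count_def)
qed

section \<open>The recursion for (pix, lec, inv)\<close>

definition pix_sum :: "real \<Rightarrow> real \<Rightarrow> real \<Rightarrow> 'a::linorder set \<Rightarrow> real" where
  "pix_sum q t x S = (\<Sum>w\<in>permutations_of_set S. x ^ pix w * t ^ lec w * q ^ inv_stat w)"

text \<open>The sorted word gives \<open>x ^ card S\<close>. A last hook \<open>h\<close> leaves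
  \<open>pix\<close> unchanged and adds \<open>inv_stat h\<close> to both \<open>lec\<close> and
  \<open>inv_stat\<close>, hence the weight \<open>(t * q) ^ inv_stat h\<close>.\<close>

lemma pix_sum_last_hook:
  fixes S :: "'a::linorder set"
  assumes "finite S"
  shows "pix_sum q t x S = x ^ card S + (\<Sum>U\<in>Pow S.
    q ^ cross_inv U (S - U) * pix_sum q t x U * hook_count (t * q) (card (S - U)))"
proof -
  let ?wt = "\<lambda>w. x ^ pix w * t ^ lec w * q ^ inv_stat w"
  have "?wt (sorted_list_of_set S) = x ^ card S"
    by (simp add: pix_def lec_def hook_factorization_sorted inv_stat_sorted)
  moreover have "(\<Sum>w\<in>permutations_of_set U. \<Sum>h\<in>{h \<in> permutations_of_set (S - U). hook h}. ?wt (w @ h))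
      = q ^ cross_inv U (S - U) * pix_sum q t x U * hook_count (t * q) (card (S - U))"
    if "U \<in> Pow S" for U
  proof -
    let ?H = "{h \<in> permutations_of_set (S - U). hook h}"
    have "(\<Sum>w\<in>permutations_of_set U. \<Sum>h\<in>?H. ?wt (w @ h))
        = (\<Sum>w\<in>permutations_of_set U. \<Sum>h\<in>?H. q ^ cross_inv U (S - U) * (?wt w * (t * q) ^ inv_stat h))"
    proof (intro sum.cong refl)
      fix w h assume "w \<in> permutations_of_set U" "h \<in> ?H"
      then have "inv_stat (w @ h) = inv_stat w + inv_stat h + cross_inv U (S - U)" "hook h"
        by (auto simp: permutations_of_set_def inv_stat_append)
      then show "?wt (w @ h) = q ^ cross_inv U (S - U) * (?wt w * (t * q) ^ inv_stat h)"
        by (simp add: pix_def lec_def hook_factorization_append_hook power_add power_mult_distrib mult_ac)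
    qed
    also have "\<dots> = q ^ cross_inv U (S - U) * (pix_sum q t x U * (\<Sum>h\<in>?H. (t * q) ^ inv_stat h))"
      unfolding pix_sum_def sum_product by (simp only: sum_distrib_left)
    finally show ?thesis
      using assms by (simp add: sum_hooks mult_ac)
  qed
  ultimately show ?thesis
    unfolding pix_sum_def[of q t x S] sum_permutations_last_hook[OF assms] by simp
qed

text \<open>By \<open>qcoeff_mult_Pow\<close> the sum over subsets is a coefficient of W_x H, so the
  recursion becomes W_x = E_x + W_x H.\<close>

lemma pix_sum_eq_qcoeff:
  fixes S :: "'a::linorder set"
  assumes "q > 0" "finite S"
  shows "pix_sum q t x S = qcoeff q (word_gf q (t * q) x) (card S)"
  using assms(2)
proof (induction S rule: finite_psubset_induct)
  case (psubset S)
  let ?W = "word_gf q (t * q) x"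
  have "(\<Sum>U\<in>Pow S. q ^ cross_inv U (S - U) * pix_sum q t x U * hook_count (t * q) (card (S - U)))
      = (\<Sum>U\<in>Pow S. q ^ cross_inv U (S - U) * qcoeff q ?W (card U)
          * qcoeff q (hook_gf q (t * q)) (card (S - U)))"
  proof (intro sum.cong refl)
    fix U assume "U \<in> Pow S"
    moreover have "qcoeff q (hook_gf q (t * q)) m = hook_count (t * q) m" for m
      using assms(1) by (simp add: hook_gf_def qcoeff_qgf)
    ultimately show "q ^ cross_inv U (S - U) * pix_sum q t x U * hook_count (t * q) (card (S - U))
      = q ^ cross_inv U (S - U) * qcoeff q ?W (card U) * qcoeff q (hook_gf q (t * q)) (card (S - U))"
      \<comment> \<open>For \<open>U = S\<close> the factor \<open>hook_count (t * q) 0\<close> is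
        0, so the induction hypothesis is applied to proper subsets only.\<close>
      using psubset.IH[of U] by (cases "U = S") (auto simp: hook_count_def)
  qed
  also have "\<dots> = qcoeff q (?W * hook_gf q (t * q)) (card S)"
    using psubset.hyps by (rule qcoeff_mult_Pow[symmetric])
  finally have "pix_sum q t x S
      = qcoeff q (qgf q (\<lambda>n. x ^ n) + ?W * hook_gf q (t * q)) (card S)"
    using psubset.hyps assms(1) by (simp add: pix_sum_last_hook qcoeff_add qcoeff_qgf)
  then show ?case
    using word_gf_hook_recursion[of q "t * q" x] by simp
qed

section \<open>Extracting the joint distribution\<close>

text \<open>Two polynomials that agree at all positive reals have equal coefficients.\<close>

lemma card_eq_if_power_sums_eq:
  fixes f g :: "'a \<Rightarrow> nat"
  assumes "finite P" and eq: "\<And>z::real. z > 0 \<Longrightarrow> (\<Sum>p\<in>P. z ^ f p) = (\<Sum>p\<in>P. z ^ g p)"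
  shows "card {p \<in> P. f p = k} = card {p \<in> P. g p = k}"
proof -
  define A B :: "real poly" where "A = (\<Sum>p\<in>P. monom 1 (f p))" and "B = (\<Sum>p\<in>P. monom 1 (g p))"
  have "poly (A - B) z = 0" if "z > 0" for z
    using eq[OF that] by (simp add: A_def B_def poly_sum poly_monom)
  then have "{0<..} \<subseteq> {z. poly (A - B) z = 0}"
    by auto
  then have "A - B = 0"
    using poly_roots_finite[of "A - B"] infinite_Ioi[of "0::real"] finite_subset by blast
  then have "coeff A k = coeff B k"
    by simp
  moreover have "(\<Sum>p\<in>P. if h p = k then 1 else 0) = real (card {p \<in> P. h p = k})" for h :: "'a \<Rightarrow> nat"
    using sum.inter_filter[OF assms(1), of "\<lambda>_. 1::real" "\<lambda>p. h p = k"] by simp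
  ultimately show ?thesis
    by (simp add: A_def B_def coeff_sum)
qed

text \<open>Uniqueness of base-M digits with an unrestricted leading digit; it lets a single
  exponent carry three statistics.\<close>

lemma base_expansion_eq_iff:
  fixes a b c :: nat
  assumes "b < M" "c < M" "b' < M" "c' < M"
  shows "c + M * (b + M * a) = c' + M * (b' + M * a') \<longleftrightarrow> (a, b, c) = (a', b', c')"
proof
  have digit: "u mod M = u' mod M \<and> u div M = u' div M" if "u = u'" for u u' :: nat
    using that by simp
  assume *: "c + M * (b + M * a) = c' + M * (b' + M * a')"
  have "c = c'" "b + M * a = b' + M * a'"
    using digit[OF *] assms by auto
  moreover from digit[OF this(2)] have "b = b'" "a = a'"
    using assms by auto
  ultimately show "(a, b, c) = (a', b', c')"
    by simp
qed auto

theorem mainTheorem2: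
  fixes n :: nat
  assumes "n \<ge> 1"
  shows "\<forall>a b c :: nat.
    card {\<pi> \<in> permutations_of_set {1..n}. (aix \<pi>, des \<pi>, aid \<pi>) = (a, b, c)} =
    card {\<pi> \<in> permutations_of_set {1..n}. (pix \<pi>, lec \<pi>, inv_stat \<pi>) = (a, b, c)}"
proof (intro allI)
  fix a b c :: nat
  let ?P = "permutations_of_set {1..n}"
  \<comment> \<open>Any M above b, c and all values of the four statistics used as lower digits
    would do; the sum over all permutations is a crude bound.\<close>
  define M where "M = Suc (b + c + (\<Sum>\<pi>\<in>?P. des \<pi> + aid \<pi> + lec \<pi> + inv_stat \<pi>))"
  have bound: "des \<pi> < M \<and> aid \<pi> < M \<and> lec \<pi> < M \<and> inv_stat \<pi> < M" if "\<pi> \<in> ?P" for \<pi>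
    using member_le_sum[of \<pi> ?P "\<lambda>\<pi>. des \<pi> + aid \<pi> + lec \<pi> + inv_stat \<pi>"] that
    by (auto simp: M_def)
  have bc: "b < M" "c < M"
    by (simp_all add: M_def)
  define f where "f \<pi> = aid \<pi> + M * (des \<pi> + M * aix \<pi>)" for \<pi> :: "nat list"
  define g where "g \<pi> = inv_stat \<pi> + M * (lec \<pi> + M * pix \<pi>)" for \<pi> :: "nat list"
  define k where "k = c + M * (b + M * a)"
  have "(\<Sum>\<pi>\<in>?P. z ^ f \<pi>) = (\<Sum>\<pi>\<in>?P. z ^ g \<pi>)" if "z > 0" for z :: real
  proof -
    have "(\<Sum>\<pi>\<in>?P. z ^ f \<pi>) = aix_sum z (z ^ M) (z ^ (M * M)) {1..n}"
      by (simp add: aix_sum_def f_def power_add power_mult algebra_simps)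
    also have "\<dots> = pix_sum z (z ^ M) (z ^ (M * M)) {1..n}"
      using that by (simp add: aix_sum_eq_qcoeff pix_sum_eq_qcoeff)
    also have "\<dots> = (\<Sum>\<pi>\<in>?P. z ^ g \<pi>)"
      by (simp add: pix_sum_def g_def power_add power_mult algebra_simps)
    finally show ?thesis .
  qed
  then have "card {\<pi> \<in> ?P. f \<pi> = k} = card {\<pi> \<in> ?P. g \<pi> = k}"
    by (intro card_eq_if_power_sums_eq) auto
  moreover have "{\<pi> \<in> ?P. f \<pi> = k} = {\<pi> \<in> ?P. (aix \<pi>, des \<pi>, aid \<pi>) = (a, b, c)}"
    using bound bc unfolding f_def k_def
    by (intro Collect_cong conj_cong refl base_expansion_eq_iff) auto
  moreover have "{\<pi> \<in> ?P. g \<pi> = k} = {\<pi> \<in> ?P. (pix \<pi>, lec \<pi>, inv_stat \<pi>) = (a, b, c)}"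
    using bound bc unfolding g_def k_def
    by (intro Collect_cong conj_cong refl base_expansion_eq_iff) auto
  ultimately show "card {\<pi> \<in> ?P. (aix \<pi>, des \<pi>, aid \<pi>) = (a, b, c)} =
      card {\<pi> \<in> ?P. (pix \<pi>, lec \<pi>, inv_stat \<pi>) = (a, b, c)}"
    by simp
qed

end
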